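(* Let $a,b,p,q$ be real numbers with $p^2+4q>0$ and $q\neq 0$, and let $\alpha,\beta$ be the roots of $t^2-pt-q=0$ with $\alpha-\beta=\sqrt{p^2+4q}$. Put $A=b-a\beta$, $B=b-a\alpha$ and $\boldsymbol{\omega}=(1-p)\mathbf{i}-q\boldsymbol{\varepsilon}+(p^{2}+q+1)\mathbf{h}$. Then for all integers $m\geq r\geq 0$, $$\mathbb{H}\mathcal{J}_{m}^{2}-\mathbb{H}\mathcal{J}_{m+r}\mathbb{H}\mathcal{J}_{m-r}=-AB(-q)^{m}\mathcal{F}_{-r}\left[\left(\mathbb{H}\mathcal{L}_{0}-(q^{3}+pq-q+1)\right)\mathcal{F}_{r}+q(\mathbb{H}\mathcal{F}_{0}-\boldsymbol{\omega})\mathcal{L}_{r}\right],$$ where $\mathcal{F}_r$ and $\mathcal{L}_r$ are the $r$-th $(p,q)$-Fibonacci and $(p,q)$-Lucas numbers.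
   Context: The hybrid numbers $\mathbb{K}$ are the 4-dimensional associative unital real algebra with basis $1,\mathbf{i},\boldsymbol{\varepsilon},\mathbf{h}$ and multiplication $\mathbf{i}^2=-1$, $\boldsymbol{\varepsilon}^2=0$, $\mathbf{h}^2=1$, $\mathbf{i}\boldsymbol{\varepsilon}=1-\mathbf{h}$, $\boldsymbol{\varepsilon}\mathbf{i}=1+\mathbf{h}$, $\mathbf{i}\mathbf{h}=\boldsymbol{\varepsilon}+\mathbf{i}$, $\mathbf{h}\mathbf{i}=-(\boldsymbol{\varepsilon}+\mathbf{i})$, $\boldsymbol{\varepsilon}\mathbf{h}=-\boldsymbol{\varepsilon}$, $\mathbf{h}\boldsymbol{\varepsilon}=\boldsymbol{\varepsilon}$. Real numbers are identified with real multiples of $1$. The generalized hybrid Fibonacci numbers with real parameters $a,b,p,q$ are defined by $\mathbb{H}\mathcal{J}_{n}=p\mathbb{H}\mathcal{J}_{n-1}+q\mathbb{H}\mathcal{J}_{n-2}$ for $n\ge 2$, with $\mathbb{H}\mathcal{J}_{0}=a+b\mathbf{i}+(pb+qa)\boldsymbol{\varepsilon}+((p^{2}+q)b+pqa)\mathbf{h}$ and $\mathbb{H}\mathcal{J}_{1}=b+(pb+qa)\mathbf{i}+((p^{2}+q)b+pqa)\boldsymbol{\varepsilon}+((p^{3}+2pq)b+q(p^{2}+q)a)\mathbf{h}$. The $(p,q)$-Fibonacci numbers: $\mathcal{F}_0=0$, $\mathcal{F}_1=1$, $\mathcal{F}_n=p\mathcal{F}_{n-1}+q\mathcal{F}_{n-2}$,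 extended to negative indices by the same recurrence (so $\mathcal{F}_{-r}=-(-q)^{-r}\mathcal{F}_r$). The $(p,q)$-Lucas numbers: $\mathcal{L}_0=2$, $\mathcal{L}_1=p$, $\mathcal{L}_n=p\mathcal{L}_{n-1}+q\mathcal{L}_{n-2}$. The hybrid versions are $\mathbb{H}\mathcal{F}_{n}=\mathcal{F}_{n}+\mathcal{F}_{n+1}\mathbf{i}+\mathcal{F}_{n+2}\boldsymbol{\varepsilon}+\mathcal{F}_{n+3}\mathbf{h}$ and $\mathbb{H}\mathcal{L}_{n}=\mathcal{L}_{n}+\mathcal{L}_{n+1}\mathbf{i}+\mathcal{L}_{n+2}\boldsymbol{\varepsilon}+\mathcal{L}_{n+3}\mathbf{h}$. *)

theory Defs
  imports Complex_Main
begin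

text \<open>\<open>Hybrid x y z w\<close> is the hybrid number \<open>x + y i + z \<epsilon> + w h\<close>; see \<open>Hybrid_eq\<close> below.\<close>

datatype hybrid = Hybrid (hyb_1: real) (hyb_i: real) (hyb_eps: real) (hyb_h: real)

lemma hybrid_eq_iff:
  "x = y \<longleftrightarrow> hyb_1 x = hyb_1 y \<and> hyb_i x = hyb_i y \<and> hyb_eps x = hyb_eps y \<and> hyb_h x = hyb_h y"
  by (cases x; cases y) simp

instantiation hybrid :: real_algebra_1
begin

definition zero_hybrid :: hybrid where
  "0 = Hybrid 0 0 0 0"

definition one_hybrid :: hybrid where
  "1 = Hybrid 1 0 0 0"

definition plus_hybrid :: "hybrid \<Rightarrow> hybrid \<Rightarrow> hybrid" where
  "x + y = Hybrid (hyb_1 x + hyb_1 y) (hyb_i x + hyb_i y) (hyb_eps x + hyb_eps y) (hyb_h x + hyb_h y)"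

definition uminus_hybrid :: "hybrid \<Rightarrow> hybrid" where
  "- x = Hybrid (- hyb_1 x) (- hyb_i x) (- hyb_eps x) (- hyb_h x)"

definition minus_hybrid :: "hybrid \<Rightarrow> hybrid \<Rightarrow> hybrid" where
  "x - y = Hybrid (hyb_1 x - hyb_1 y) (hyb_i x - hyb_i y) (hyb_eps x - hyb_eps y) (hyb_h x - hyb_h y)"

definition scaleR_hybrid :: "real \<Rightarrow> hybrid \<Rightarrow> hybrid" where
  "c *\<^sub>R x = Hybrid (c * hyb_1 x) (c * hyb_i x) (c * hyb_eps x) (c * hyb_h x)"

text \<open>The bilinear extension of the multiplication table of the basis, which is
  recovered in \<open>hybrid_mult_table\<close> below.\<close>

definition times_hybrid :: "hybrid \<Rightarrow> hybrid \<Rightarrow> hybrid" where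
  "x * y = Hybrid
     (hyb_1 x * hyb_1 y - hyb_i x * hyb_i y + hyb_i x * hyb_eps y + hyb_eps x * hyb_i y + hyb_h x * hyb_h y)
     (hyb_1 x * hyb_i y + hyb_i x * hyb_1 y + hyb_i x * hyb_h y - hyb_h x * hyb_i y)
     (hyb_1 x * hyb_eps y + hyb_eps x * hyb_1 y + hyb_i x * hyb_h y - hyb_h x * hyb_i y
        - hyb_eps x * hyb_h y + hyb_h x * hyb_eps y)
     (hyb_1 x * hyb_h y + hyb_h x * hyb_1 y - hyb_i x * hyb_eps y + hyb_eps x * hyb_i y)"

instance
  by standard
    (simp_all add: hybrid_eq_iff zero_hybrid_def one_hybrid_def plus_hybrid_def uminus_hybrid_def
      minus_hybrid_def scaleR_hybrid_def times_hybrid_def algebra_simps)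

end

definition ii :: hybrid where "ii = Hybrid 0 1 0 0"
definition eps :: hybrid where "eps = Hybrid 0 0 1 0"
definition hh :: hybrid where "hh = Hybrid 0 0 0 1"

lemmas hybrid_defs = zero_hybrid_def one_hybrid_def plus_hybrid_def uminus_hybrid_def
  minus_hybrid_def scaleR_hybrid_def times_hybrid_def ii_def eps_def hh_def

lemma Hybrid_eq: "Hybrid x y z w = of_real x + y *\<^sub>R ii + z *\<^sub>R eps + w *\<^sub>R hh"
  by (simp add: of_real_def hybrid_defs)

lemma hybrid_mult_table:
  "ii * ii = -1" "eps * eps = 0" "hh * hh = 1"
  "ii * eps = 1 - hh" "eps * ii = 1 + hh"
  "ii * hh = eps + ii" "hh * ii = - (eps + ii)"
  "eps * hh = - eps" "hh * eps = eps"
  by (simp_all add: hybrid_defs)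

fun HJ :: "real \<Rightarrow> real \<Rightarrow> real \<Rightarrow> real \<Rightarrow> nat \<Rightarrow> hybrid" where
  "HJ a b p q 0 =
     Hybrid a b (p * b + q * a) ((p^2 + q) * b + p * q * a)"
| "HJ a b p q (Suc 0) =
     Hybrid b (p * b + q * a) ((p^2 + q) * b + p * q * a)
       ((p^3 + 2 * p * q) * b + q * (p^2 + q) * a)"
| "HJ a b p q (Suc (Suc n)) = p *\<^sub>R HJ a b p q (Suc n) + q *\<^sub>R HJ a b p q n"

text \<open>The \<open>(p,q)\<close>-Fibonacci numbers on all integer indices.  For negative \<open>n\<close> the recurrence
  \<open>F (n + 2) = p * F (n + 1) + q * F n\<close> is solved for \<open>F n\<close>; this is meaningful only for \<open>q \<noteq> 0\<close>.\<close>

function pq_fib :: "real \<Rightarrow> real \<Rightarrow> int \<Rightarrow> real" where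
  "pq_fib p q n =
     (if n = 0 then 0
      else if n = 1 then 1
      else if n \<ge> 2 then p * pq_fib p q (n - 1) + q * pq_fib p q (n - 2)
      else (pq_fib p q (n + 2) - p * pq_fib p q (n + 1)) / q)"
  by pat_completeness auto
termination
  by (relation "measure (\<lambda>(p, q, n). nat \<bar>2 * n - 1\<bar>)") auto

declare pq_fib.simps [simp del]

lemma pq_fib_0: "pq_fib p q 0 = 0" and pq_fib_1: "pq_fib p q 1 = 1"
  by (simp_all add: pq_fib.simps)

lemma pq_fib_rec:
  assumes "q \<noteq> 0"
  shows "pq_fib p q n = p * pq_fib p q (n - 1) + q * pq_fib p q (n - 2)"
proof (cases "n \<ge> 2")
  case True
  then show ?thesis by (subst pq_fib.simps) simp
next
  case False
  then have "pq_fib p q (n - 2) = (pq_fib p q n - p * pq_fib p q (n - 1)) / q"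
    by (subst pq_fib.simps) (simp add: algebra_simps)
  then show ?thesis using assms by simp
qed

lemma pq_fib_uminus:
  assumes "q \<noteq> 0"
  shows "pq_fib p q (- int r) = - pq_fib p q (int r) / (- q) ^ r"
proof (induction r rule: induct_nat_012)
  case 0
  then show ?case by (simp add: pq_fib_0)
next
  case 1
  show ?case using pq_fib_rec[OF assms, of p 1] assms
    by (simp add: pq_fib_0 pq_fib_1 field_simps)
next
  case (ge2 n)
  have a: "pq_fib p q (- int n) = p * pq_fib p q (- int (Suc n)) + q * pq_fib p q (- int (Suc (Suc n)))"
  proof -
    have "- int n - 1 = - int (Suc n)" "- int n - 2 = - int (Suc (Suc n))" by simp_all
    then show ?thesis using pq_fib_rec[OF assms, of p "- int n"] by metis
  qed
  have b: "pq_fib p q (int (Suc (Suc n))) = p * pq_fib p q (int (Suc n)) + q * pq_fib p q (int n)"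
  proof -
    have "int (Suc (Suc n)) - 1 = int (Suc n)" "int (Suc (Suc n)) - 2 = int n" by simp_all
    then show ?thesis using pq_fib_rec[OF assms, of p "int (Suc (Suc n))"] by metis
  qed
  have "pq_fib p q (- int (Suc (Suc n))) =
      (pq_fib p q (- int n) - p * pq_fib p q (- int (Suc n))) / q"
    using a assms by (simp add: field_simps)
  also have "\<dots> = - pq_fib p q (int (Suc (Suc n))) / (- q) ^ Suc (Suc n)"
    unfolding ge2 b using assms by (simp add: field_simps)
  finally show ?case .
qed

fun pq_lucas :: "real \<Rightarrow> real \<Rightarrow> nat \<Rightarrow> real" where
  "pq_lucas p q 0 = 2"
| "pq_lucas p q (Suc 0) = p"
| "pq_lucas p q (Suc (Suc n)) = p * pq_lucas p q (Suc n) + q * pq_lucas p q n"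

definition HF :: "real \<Rightarrow> real \<Rightarrow> int \<Rightarrow> hybrid" where
  "HF p q n = Hybrid (pq_fib p q n) (pq_fib p q (n + 1)) (pq_fib p q (n + 2)) (pq_fib p q (n + 3))"

definition HL :: "real \<Rightarrow> real \<Rightarrow> nat \<Rightarrow> hybrid" where
  "HL p q n = Hybrid (pq_lucas p q n) (pq_lucas p q (n + 1)) (pq_lucas p q (n + 2)) (pq_lucas p q (n + 3))"

end

theory Submission
  imports Defs
begin

text \<open>Every \<open>HJ a b p q n\<close> is the initial vector \<open>HJ x y p q 0\<close> of the same recurrence started at
  \<open>(x, y)\<close>, and the form \<open>y\<^sup>2 - p x y - q x\<^sup>2\<close> gets multiplied by \<open>- q\<close> at each step; initially it is
  \<open>A B\<close>. With \<open>n = m - r\<close> this reduces the claim to an identity that holds for arbitrary values in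
  place of the Fibonacci numbers \<open>f = F r\<close> and \<open>g = F (r + 1)\<close>: going \<open>r\<close> steps ahead is the linear map
  \<open>f C + (g - p f)\<close>, \<open>C\<close> being the companion matrix.\<close>

text \<open>The coordinates of \<open>HJ\<close> at 0 and 1 are terms 0 to 3 and 1 to 4 of the
  scalar sequence with the same recurrence started at \<open>a\<close>, \<open>b\<close>.\<close>

lemma HJ_shift: "HJ a b p q (Suc n) = HJ b (p * b + q * a) p q n"
  by (induction n rule: induct_nat_012)
    (simp_all add: hybrid_defs algebra_simps power2_eq_square power3_eq_cube)

lemma HJ_add:
  assumes "HJ a b p q n = HJ x y p q 0"
  shows "HJ a b p q (n + r) = HJ x y p q r"
proof (induction r rule: induct_nat_012)
  case 0
  then show ?case using assms by simp
next
  case 1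
  \<comment> \<open>One equation between values suffices for a second-order recurrence here:
    \<open>HJ x y p q 0\<close> displays \<open>x\<close> and \<open>y\<close> as its first two
    coordinates. Shifting the seeds brings \<open>n\<close> down to 0, where the assumption gives
    \<open>a = x\<close> and \<open>b = y\<close>.\<close>
  have "HJ a b p q (Suc n) = HJ x y p q (Suc 0)"
    using assms
  proof (induction n arbitrary: a b)
    case 0
    then show ?case by simp
  next
    case (Suc n)
    from Suc.IH[of b "p * b + q * a"] Suc.prems show ?case
      by (simp only: HJ_shift[of a b])
  qed
  then show ?case by simp
next
  case (ge2 n)
  then show ?case by simp
qed

lemma HJ_step:
  assumes "HJ a b p q n = HJ x y p q 0"
  shows "HJ a b p q (Suc n) = HJ y (p * y + q * x) p q 0"
  using HJ_add[OF assms, of 1] HJ_shift[of x y p q 0] by simp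

lemma HJ_as_initial:
  obtains x y where "HJ a b p q n = HJ x y p q 0"
    and "y^2 - p * x * y - q * x^2 = (- q)^n * (b^2 - p * a * b - q * a^2)"
proof -
  have "\<exists>x y. HJ a b p q n = HJ x y p q 0 \<and>
      y^2 - p * x * y - q * x^2 = (- q)^n * (b^2 - p * a * b - q * a^2)"
  proof (induction n)
    case 0
    show ?case by (intro exI[of _ a] exI[of _ b]) simp
  next
    case (Suc n)
    then obtain x y where xy: "HJ a b p q n = HJ x y p q 0"
      and D: "y^2 - p * x * y - q * x^2 = (- q)^n * (b^2 - p * a * b - q * a^2)" by blast
    have "(p * y + q * x)^2 - p * y * (p * y + q * x) - q * y^2
        = - q * (y^2 - p * x * y - q * x^2)"
      by (simp add: algebra_simps power2_eq_square)
    also have "\<dots> = (- q)^Suc n * (b^2 - p * a * b - q * a^2)"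
      unfolding D by simp
    finally show ?case using HJ_step[OF xy] by blast
  qed
  then show thesis using that by blast
qed

lemma pq_fib_Suc_Suc:
  "pq_fib p q (int (Suc (Suc n))) = p * pq_fib p q (int (Suc n)) + q * pq_fib p q (int n)"
proof -
  have "int (Suc (Suc n)) - 1 = int (Suc n)" "int (Suc (Suc n)) - 2 = int n" by simp_all
  then show ?thesis by (subst pq_fib.simps) simp
qed

text \<open>The coefficient \<open>f (Suc r) - p * f r\<close> stands for q F(r - 1), written so
  that no negative index occurs at \<open>r = 0\<close>.\<close>

lemma HJ_eq_pq_fib:
  fixes p q x y :: real
  defines "f \<equiv> \<lambda>r. pq_fib p q (int r)"
  shows "HJ x y p q r =
    HJ (f r * y + (f (Suc r) - p * f r) * x) (f (Suc r) * y + q * f r * x) p q 0"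
proof (induction r)
  case 0
  show ?case by (simp add: f_def pq_fib_0 pq_fib_1)
next
  case (Suc r)
  have "f (Suc (Suc r)) = p * f (Suc r) + q * f r"
    unfolding f_def by (rule pq_fib_Suc_Suc)
  then show ?case
    using HJ_step[OF Suc] by (simp add: algebra_simps)
qed

text \<open>Both sides solve the same recurrence with initial values 2 and p. This eliminates the
  Lucas numbers in favour of \<open>f\<close> and \<open>g\<close>.\<close>

lemma pq_lucas_eq_pq_fib:
  "pq_lucas p q r = 2 * pq_fib p q (int (Suc r)) - p * pq_fib p q (int r)"
proof (induction r rule: induct_nat_012)
  case 0
  then show ?case by (simp add: pq_fib_0 pq_fib_1)
next
  case 1
  then show ?case using pq_fib_Suc_Suc[of p q 0] by (simp add: pq_fib_0 pq_fib_1)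
next
  case (ge2 n)
  then show ?case
    by (simp only: pq_fib_Suc_Suc pq_lucas.simps) (simp only: algebra_simps)
qed

lemma HL_0: "HL p q 0 = Hybrid 2 p (p^2 + 2 * q) (p^3 + 3 * p * q)"
  by (simp add: HL_def numeral_2_eq_2 numeral_3_eq_3 algebra_simps)

lemma HF_0: "HF p q 0 = Hybrid 0 1 p (p^2 + q)"
  using pq_fib_Suc_Suc[of p q 0] pq_fib_Suc_Suc[of p q 1]
  by (simp add: HF_def pq_fib_0 pq_fib_1 power2_eq_square)

text \<open>The seeds (x, y), (u, v) and those of the first factor belong to the indices m - r, m
  and m + r. The factor \<open>2 * g - p * f\<close>, later L(r), is the trace of f C + (g - p f).
  Each coordinate is a polynomial identity.\<close>

lemma hybrid_catalan_identity:
  fixes f g p q x y :: real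
  defines "u \<equiv> f * y + (g - p * f) * x" and "v \<equiv> g * y + q * f * x"
  shows "(HJ u v p q 0)^2 -
      HJ (f * v + (g - p * f) * u) (g * v + q * f * u) p q 0 * HJ x y p q 0 =
    ((y^2 - p * x * y - q * x^2) * f) *\<^sub>R
      (f *\<^sub>R (HL p q 0 - of_real (q^3 + p * q - q + 1))
        + (q * (2 * g - p * f)) *\<^sub>R
          (HF p q 0 - ((1 - p) *\<^sub>R ii - q *\<^sub>R eps + (p^2 + q + 1) *\<^sub>R hh)))"
  unfolding u_def v_def power2_eq_square[of "HJ _ _ _ _ _"] HL_0 HF_0 of_real_def
  by (simp add: hybrid_defs) (intro conjI; algebra)

lemma sum_prod_of_quadratic_roots:
  fixes \<alpha> \<beta> p q :: real
  assumes "{t. t^2 - p * t - q = 0} = {\<alpha>, \<beta>}" and "\<alpha> \<noteq> \<beta>"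
  shows "\<alpha> + \<beta> = p" and "\<alpha> * \<beta> = - q"
proof -
  have *: "\<alpha>^2 - p * \<alpha> - q = 0" "\<beta>^2 - p * \<beta> - q = 0"
    using assms(1) by blast+
  then have "(\<alpha> - \<beta>) * (\<alpha> + \<beta> - p) = 0"
    by algebra
  with assms(2) show "\<alpha> + \<beta> = p" by simp
  with * show "\<alpha> * \<beta> = - q" by algebra
qed

theorem theorem2p4:
  fixes a b p q \<alpha> \<beta> A B :: real and \<omega> :: hybrid and m r :: nat
  assumes "p^2 + 4 * q > 0" and "q \<noteq> 0"
    and "{t :: real. t^2 - p * t - q = 0} = {\<alpha>, \<beta>}"
    and "\<alpha> - \<beta> = sqrt (p^2 + 4 * q)"
    and "A = b - a * \<beta>" and "B = b - a * \<alpha>"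
    and "\<omega> = (1 - p) *\<^sub>R ii - q *\<^sub>R eps + (p^2 + q + 1) *\<^sub>R hh"
    and "r \<le> m"
  shows "(HJ a b p q m)^2 - HJ a b p q (m + r) * HJ a b p q (m - r) =
    (- (A * B * (- q)^m * pq_fib p q (- int r))) *\<^sub>R
      (pq_fib p q (int r) *\<^sub>R (HL p q 0 - of_real (q^3 + p * q - q + 1))
        + (q * pq_lucas p q r) *\<^sub>R (HF p q 0 - \<omega>))"
proof -
  define n where "n = m - r"
  have m: "m = n + r" using \<open>r \<le> m\<close> by (simp add: n_def)
  have "\<alpha> \<noteq> \<beta>" using assms(1,4) by auto
  note roots = sum_prod_of_quadratic_roots[OF assms(3) this]
  have AB: "A * B = b^2 - p * a * b - q * a^2"
  proof -
    have "A * B = b^2 - (\<alpha> + \<beta>) * a * b + (\<alpha> * \<beta>) * a^2"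
      by (simp add: assms(5,6) power2_eq_square algebra_simps)
    then show ?thesis by (simp add: roots)
  qed
  obtain x y where xy: "HJ a b p q n = HJ x y p q 0"
    and D: "y^2 - p * x * y - q * x^2 = (- q)^n * (b^2 - p * a * b - q * a^2)"
    by (rule HJ_as_initial)
  define f where "f = pq_fib p q (int r)"
  define g where "g = pq_fib p q (int (Suc r))"
  define u where "u = f * y + (g - p * f) * x"
  define v where "v = g * y + q * f * x"
  have uv: "HJ a b p q m = HJ u v p q 0"
    unfolding m u_def v_def f_def g_def HJ_add[OF xy] by (rule HJ_eq_pq_fib)
  have "HJ a b p q (m + r) = HJ (f * v + (g - p * f) * u) (g * v + q * f * u) p q 0"
    unfolding f_def g_def HJ_add[OF uv] by (rule HJ_eq_pq_fib)
  \<comment> \<open>F(-r) = -f / (-q)^r absorbs the minus sign and lowers (-q)^(n + r) to (-q)^n,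
    which is the factor in \<open>D\<close>.\<close>
  moreover have "- (A * B * (- q)^m * pq_fib p q (- int r)) = (y^2 - p * x * y - q * x^2) * f"
    unfolding pq_fib_uminus[OF \<open>q \<noteq> 0\<close>] AB D m f_def using \<open>q \<noteq> 0\<close>
    by (simp add: power_add field_simps)
  moreover have "pq_lucas p q r = 2 * g - p * f"
    unfolding f_def g_def by (rule pq_lucas_eq_pq_fib)
  ultimately show ?thesis
    using hybrid_catalan_identity[where f = f and g = g and p = p and q = q and x = x and y = y]
    unfolding n_def[symmetric] uv xy assms(7) f_def[symmetric] u_def[symmetric] v_def[symmetric]
    by simp
qed

end
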